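(* Let $\mathcal{L}$ be a fixed first-order language, let $\mathcal{C}$ be a class of countable $\mathcal{L}$-structures, and let $\mathcal{M}\in\mathcal{C}$ be a symmetrically indivisible structure such that $C\lesssim_s\mathcal{M}$ for every $C\in\mathcal{C}$. Let $+^{\mathcal{C}}$ be a binary operation on $\mathcal{C}$ such that for all $C_1,C_2\in\mathcal{C}$, $\mathcal{M}+^{\mathcal{C}}C_1\cong\mathcal{M}+^{\mathcal{C}}C_2$ implies $C_1\cong C_2$, and for all $A,B\in\mathcal{C}$, $A\lesssim_s A+^{\mathcal{C}}B$ and $B\lesssim_s A+^{\mathcal{C}}B$. Then there is a one-to-one map from the structures of $\mathcal{C}$ up to isomorphism into the symmetrically indivisible structures of $\mathcal{C}$ up to isomorphism.
   Context: An embedding $e:\mathcal{N}\to\mathcal{M}$ of $\mathcal{L}$-structures is symmetric if every automorphism of $e[\mathcal{N}]$ extends to an automorphism of $\mathcal{M}$. Write $\mathcal{N}\lesssim_s\mathcal{M}$ if there is a symmetric embedding of $\mathcal{N}$ into $\mathcal{M}$. A substructure is symmetrically embedded if its inclusion map is symmetric. A structure $\mathcal{M}$ is symmetrically indivisible if for every colouring of its universe in two colours there is a monochromatic substructure $\mathcal{M}'\subseteq\mathcal{M}$ such that $\mathcal{M}'\cong\mathcal{M}$ and $\mathcal{M}'$ is symmetrically embedded in $\mathcal{M}$. *)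

theory Defs
  imports Main "HOL-Library.FuncSet" "HOL-Library.Countable_Set"
begin

(* The symbols are explicit sets, since HOL types are nonempty and a language may lack
   function symbols or relation symbols.  Constants are function symbols of arity 0. *)
record ('f, 'r) language =
  fsyms :: "'f set"
  rsyms :: "'r set"
  farity :: "'f \<Rightarrow> nat"
  rarity :: "'r \<Rightarrow> nat"

record ('f, 'r, 'a) fo_structure =
  univ :: "'a set"
  funs :: "'f \<Rightarrow> 'a list \<Rightarrow> 'a"
  rels :: "'r \<Rightarrow> 'a list set"

definition tuples :: "'a set \<Rightarrow> nat \<Rightarrow> 'a list set" where
  "tuples A n = {xs. length xs = n \<and> set xs \<subseteq> A}"

(* Interpretations are extensional, so that HOL equality of records is equality of
   structures. *)
definition is_structure :: "('f, 'r) language \<Rightarrow> ('f, 'r, 'a) fo_structure \<Rightarrow> bool" where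
  "is_structure L M \<longleftrightarrow>
     univ M \<noteq> {} \<and>
     funs M \<in> (\<Pi>\<^sub>E f\<in>fsyms L. tuples (univ M) (farity L f) \<rightarrow>\<^sub>E univ M) \<and>
     rels M \<in> (\<Pi>\<^sub>E r\<in>rsyms L. Pow (tuples (univ M) (rarity L r)))"

definition embedding ::
  "('f, 'r) language \<Rightarrow> ('f, 'r, 'a) fo_structure \<Rightarrow> ('f, 'r, 'b) fo_structure \<Rightarrow> ('a \<Rightarrow> 'b) \<Rightarrow> bool"
  where
  "embedding L N M e \<longleftrightarrow>
     e \<in> univ N \<rightarrow> univ M \<and> inj_on e (univ N) \<and>
     (\<forall>f\<in>fsyms L. \<forall>xs\<in>tuples (univ N) (farity L f). e (funs N f xs) = funs M f (map e xs)) \<and>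
     (\<forall>r\<in>rsyms L. \<forall>xs\<in>tuples (univ N) (rarity L r). xs \<in> rels N r \<longleftrightarrow> map e xs \<in> rels M r)"

definition isomorphism ::
  "('f, 'r) language \<Rightarrow> ('f, 'r, 'a) fo_structure \<Rightarrow> ('f, 'r, 'b) fo_structure \<Rightarrow> ('a \<Rightarrow> 'b) \<Rightarrow> bool"
  where
  "isomorphism L N M h \<longleftrightarrow> embedding L N M h \<and> h ` univ N = univ M"

definition isomorphic ::
  "('f, 'r) language \<Rightarrow> ('f, 'r, 'a) fo_structure \<Rightarrow> ('f, 'r, 'b) fo_structure \<Rightarrow> bool"
  where
  "isomorphic L N M \<longleftrightarrow> (\<exists>h. isomorphism L N M h)"

definition automorphism ::
  "('f, 'r) language \<Rightarrow> ('f, 'r, 'a) fo_structure \<Rightarrow> ('a \<Rightarrow> 'a) \<Rightarrow> bool" where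
  "automorphism L M h \<longleftrightarrow> isomorphism L M M h"

(* Only meaningful when A is closed under the functions of M. *)
definition induced ::
  "('f, 'r) language \<Rightarrow> ('f, 'r, 'a) fo_structure \<Rightarrow> 'a set \<Rightarrow> ('f, 'r, 'a) fo_structure" where
  "induced L M A =
     \<lparr>univ = A,
      funs = (\<lambda>f\<in>fsyms L. \<lambda>xs\<in>tuples A (farity L f). funs M f xs),
      rels = (\<lambda>r\<in>rsyms L. rels M r \<inter> tuples A (rarity L r))\<rparr>"

(* "induced L M (e ` univ N)" is the substructure e[N] of M.  Automorphisms are HOL functions,
   only their values on the universe matter; hence "extends" is agreement on e[N]. *)
definition symmetric_embedding ::
  "('f, 'r) language \<Rightarrow> ('f, 'r, 'a) fo_structure \<Rightarrow> ('f, 'r, 'b) fo_structure \<Rightarrow> ('a \<Rightarrow> 'b) \<Rightarrow> bool"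
  where
  "symmetric_embedding L N M e \<longleftrightarrow>
     embedding L N M e \<and>
     (\<forall>g. automorphism L (induced L M (e ` univ N)) g \<longrightarrow>
        (\<exists>h. automorphism L M h \<and> (\<forall>x\<in>e ` univ N. h x = g x)))"

definition sym_embeds ::
  "('f, 'r) language \<Rightarrow> ('f, 'r, 'a) fo_structure \<Rightarrow> ('f, 'r, 'b) fo_structure \<Rightarrow> bool"
  where
  "sym_embeds L N M \<longleftrightarrow> (\<exists>e. symmetric_embedding L N M e)"

definition substructure ::
  "('f, 'r) language \<Rightarrow> ('f, 'r, 'a) fo_structure \<Rightarrow> ('f, 'r, 'a) fo_structure \<Rightarrow> bool" where
  "substructure L N M \<longleftrightarrow>
     is_structure L N \<and> univ N \<subseteq> univ M \<and> embedding L N M (\<lambda>x. x)"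

definition sym_embedded ::
  "('f, 'r) language \<Rightarrow> ('f, 'r, 'a) fo_structure \<Rightarrow> ('f, 'r, 'a) fo_structure \<Rightarrow> bool" where
  "sym_embedded L N M \<longleftrightarrow> substructure L N M \<and> symmetric_embedding L N M (\<lambda>x. x)"

definition symmetrically_indivisible ::
  "('f, 'r) language \<Rightarrow> ('f, 'r, 'a) fo_structure \<Rightarrow> bool" where
  "symmetrically_indivisible L M \<longleftrightarrow>
     (\<forall>c :: 'a \<Rightarrow> bool. \<exists>M'.
        substructure L M' M \<and> (\<exists>k. \<forall>x\<in>univ M'. c x = k) \<and>
        isomorphic L M' M \<and> sym_embedded L M' M)"

definition iso_rel ::
  "('f, 'r) language \<Rightarrow> ('f, 'r, 'a) fo_structure set \<Rightarrow>
     (('f, 'r, 'a) fo_structure \<times> ('f, 'r, 'a) fo_structure) set" where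
  "iso_rel L S = {(A, B). A \<in> S \<and> B \<in> S \<and> isomorphic L A B}"

definition iso_classes ::
  "('f, 'r) language \<Rightarrow> ('f, 'r, 'a) fo_structure set \<Rightarrow> ('f, 'r, 'a) fo_structure set set" where
  "iso_classes L S = S // iso_rel L S"

end

theory Submission
  imports Defs
begin

text \<open>
  If \<open>A\<close> and \<open>M\<close> embed symmetrically into each other and \<open>M\<close> is symmetrically indivisible, then so is
  \<open>A\<close>: pull a colouring of \<open>A\<close> back along \<open>M \<rightarrow> A\<close>, choose a monochromatic symmetric copy \<open>M'\<close> of \<open>M\<close>,
  and take the image of the symmetric composite \<open>A \<rightarrow> M \<cong> M' \<subseteq> M \<rightarrow> A\<close>. This applies to every
  structure \<open>M + A\<close>, so \<open>A \<mapsto> M + A\<close> induces the required injection.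
\<close>

section \<open>Composition and inversion of embeddings and isomorphisms\<close>

lemma tuples_map:
  assumes "e \<in> A \<rightarrow> B" "xs \<in> tuples A n"
  shows "map e xs \<in> tuples B n"
  using assms by (auto simp: tuples_def)

lemma funs_in_univ:
  assumes "is_structure L M" "f \<in> fsyms L" "xs \<in> tuples (univ M) (farity L f)"
  shows "funs M f xs \<in> univ M"
  using assms unfolding is_structure_def by (meson PiE_mem)

lemma embedding_comp:
  assumes d: "embedding L N M d" and e: "embedding L M K e"
  shows "embedding L N K (e \<circ> d)"
proof -
  have dm: "d \<in> univ N \<rightarrow> univ M" and em: "e \<in> univ M \<rightarrow> univ K"
    using d e by (auto simp: embedding_def)
  have "inj_on (e \<circ> d) (univ N)"
    using d e by (intro comp_inj_on) (auto simp: embedding_def intro: inj_on_subset)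
  moreover have "e \<circ> d \<in> univ N \<rightarrow> univ K"
    using dm em by auto
  moreover have "(e \<circ> d) (funs N f xs) = funs K f (map (e \<circ> d) xs)"
    if "f \<in> fsyms L" "xs \<in> tuples (univ N) (farity L f)" for f xs
    using d e that tuples_map[OF dm that(2)] by (simp add: embedding_def)
  moreover have "xs \<in> rels N r \<longleftrightarrow> map (e \<circ> d) xs \<in> rels K r"
    if "r \<in> rsyms L" "xs \<in> tuples (univ N) (rarity L r)" for r xs
    using d e that tuples_map[OF dm that(2)] by (simp add: embedding_def)
  ultimately show ?thesis
    by (simp add: embedding_def)
qed

lemma isomorphism_comp:
  assumes "isomorphism L N M d" "isomorphism L M K e"
  shows "isomorphism L N K (e \<circ> d)"
  using assms by (auto simp: isomorphism_def intro: embedding_comp simp flip: image_image)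

lemma isomorphism_id: "isomorphism L M M (\<lambda>x. x)"
  by (auto simp: isomorphism_def embedding_def)

text \<open>Closure of \<open>N\<close> under its functions is essential: it makes each value
  \<open>funs M f xs\<close> the \<open>h\<close>-image of a point of \<open>univ N\<close>, where
  \<open>inv_into\<close> cancels \<open>h\<close>.\<close>

lemma isomorphism_inv_into:
  assumes N: "is_structure L N" and h: "isomorphism L N M h"
  shows "isomorphism L M N (inv_into (univ N) h)"
proof -
  let ?k = "inv_into (univ N) h"
  have emb: "embedding L N M h" and img: "h ` univ N = univ M" and inj: "inj_on h (univ N)"
    using h by (auto simp: isomorphism_def embedding_def)
  have k: "?k \<in> univ M \<rightarrow> univ N"
    using img by (auto intro: inv_into_into)
  have hk: "map h (map ?k xs) = xs" if "xs \<in> tuples (univ M) n" for xs n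
    using that img by (auto simp: tuples_def f_inv_into_f intro!: map_idI)
  have "?k (funs M f xs) = funs N f (map ?k xs)"
    if f: "f \<in> fsyms L" and xs: "xs \<in> tuples (univ M) (farity L f)" for f xs
  proof -
    note kxs = tuples_map[OF k xs]
    have "h (funs N f (map ?k xs)) = funs M f (map h (map ?k xs))"
      using emb f kxs unfolding embedding_def by blast
    then have "funs M f xs = h (funs N f (map ?k xs))"
      by (simp only: hk[OF xs])
    then show ?thesis
      using inj funs_in_univ[OF N f kxs] by (simp add: inv_into_f_f)
  qed
  moreover have "xs \<in> rels M r \<longleftrightarrow> map ?k xs \<in> rels N r"
    if r: "r \<in> rsyms L" and xs: "xs \<in> tuples (univ M) (rarity L r)" for r xs
  proof -
    have "map ?k xs \<in> rels N r \<longleftrightarrow> map h (map ?k xs) \<in> rels M r"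
      using emb r tuples_map[OF k xs] unfolding embedding_def by blast
    then show ?thesis
      by (simp only: hk[OF xs])
  qed
  moreover have "inj_on ?k (univ M)"
    using img inj_on_inv_into[of "univ M" h "univ N"] by simp
  moreover have "?k ` univ M = univ N"
    using inj img by (metis inv_into_image_cancel subset_refl)
  ultimately show ?thesis
    using k by (simp add: isomorphism_def embedding_def)
qed

section \<open>Images of embeddings, and symmetric embeddings\<close>

lemma embedding_iso_induced:
  assumes e: "embedding L N M e"
  shows "isomorphism L N (induced L M (e ` univ N)) e"
  using e tuples_map[of e "univ N" "e ` univ N"]
  by (auto simp: isomorphism_def embedding_def induced_def)

text \<open>Every tuple over the image is the entrywise image of a tuple over \<open>N\<close>.
  Since \<open>e\<close> commutes with the functions, their values stay in the image.\<close>

lemma is_structure_induced_image: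
  assumes N: "is_structure L N" and e: "embedding L N M e"
  shows "is_structure L (induced L M (e ` univ N))"
proof -
  have "funs M f ys \<in> e ` univ N"
    if f: "f \<in> fsyms L" and ys: "ys \<in> tuples (e ` univ N) (farity L f)" for f ys
  proof -
    from ys have "ys \<in> lists (e ` univ N)"
      by (auto simp: tuples_def)
    then obtain xs where xs: "ys = map e xs" "set xs \<subseteq> univ N"
      by (auto simp: lists_image)
    with ys have "xs \<in> tuples (univ N) (farity L f)"
      by (simp add: tuples_def)
    with e f xs N show ?thesis
      by (metis embedding_def funs_in_univ imageI)
  qed
  then show ?thesis
    using N by (auto simp: is_structure_def induced_def)
qed

text \<open>Transporting automorphisms of \<open>e[N]\<close> back to \<open>N\<close> avoids image structures and makes composition
  immediate.\<close>

lemma symmetric_embedding_iff: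
  assumes N: "is_structure L N"
  shows "symmetric_embedding L N M e \<longleftrightarrow>
    embedding L N M e \<and>
    (\<forall>g. automorphism L N g \<longrightarrow> (\<exists>h. automorphism L M h \<and> (\<forall>x\<in>univ N. h (e x) = e (g x))))"
    (is "?S \<longleftrightarrow> ?E \<and> ?T")
proof (cases ?E)
  case True
  let ?I = "induced L M (e ` univ N)" and ?k = "inv_into (univ N) e"
  have e: "isomorphism L N ?I e"
    using True by (rule embedding_iso_induced)
  have k: "isomorphism L ?I N ?k"
    using N e by (rule isomorphism_inv_into)
  have ke: "?k (e x) = x" if "x \<in> univ N" for x
    using True that by (simp add: embedding_def)
  have "?S \<longleftrightarrow> ?T"
  proof
    assume S: ?S
    show ?T
    proof (intro allI impI)
      fix g assume "automorphism L N g"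
      \<comment> \<open>Conjugating \<open>g\<close> by \<open>e\<close> moves it to the image,
        where the hypothesis extends it to \<open>M\<close>.\<close>
      then have "automorphism L ?I (e \<circ> (g \<circ> ?k))"
        unfolding automorphism_def using e k by (blast intro: isomorphism_comp)
      with S obtain h where h: "automorphism L M h"
        "\<forall>x\<in>e ` univ N. h x = (e \<circ> (g \<circ> ?k)) x"
        unfolding symmetric_embedding_def by blast
      then show "\<exists>h. automorphism L M h \<and> (\<forall>x\<in>univ N. h (e x) = e (g x))"
        using ke by auto
    qed
  next
    assume T: ?T
    have "\<exists>h. automorphism L M h \<and> (\<forall>x\<in>e ` univ N. h x = g x)" if g: "automorphism L ?I g" for g
    proof -
      have "automorphism L N (?k \<circ> (g \<circ> e))"
        using g e k unfolding automorphism_def by (blast intro: isomorphism_comp)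
      with T obtain h where h: "automorphism L M h"
        "\<forall>x\<in>univ N. h (e x) = e ((?k \<circ> (g \<circ> e)) x)"
        by blast
      \<comment> \<open>\<open>e\<close> undoes \<open>?k\<close> only on the image of
        \<open>e\<close>; since \<open>g\<close> preserves that image, the point
        \<open>g (e x)\<close> qualifies.\<close>
      have "g ` e ` univ N = e ` univ N"
        using g by (simp add: automorphism_def isomorphism_def induced_def)
      then have "e (?k (g (e x))) = g (e x)" if "x \<in> univ N" for x
        using that by (metis f_inv_into_f imageI)
      with h show ?thesis
        by auto
    qed
    with True show ?S
      by (simp add: symmetric_embedding_def)
  qed
  with True show ?thesis
    by simp
qed (simp add: symmetric_embedding_def)

text \<open>Automorphisms extend in two stages: the extension from \<open>N\<close> to
  \<open>M\<close> is an automorphism of all of \<open>M\<close>, so symmetry of \<open>e\<close>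
  extends it again to \<open>K\<close>.\<close>

lemma symmetric_embedding_comp:
  assumes N: "is_structure L N" and M: "is_structure L M"
    and d: "symmetric_embedding L N M d" and e: "symmetric_embedding L M K e"
  shows "symmetric_embedding L N K (e \<circ> d)"
proof -
  have dm: "d \<in> univ N \<rightarrow> univ M"
    using d by (auto simp: symmetric_embedding_def embedding_def)
  have "\<exists>k. automorphism L K k \<and> (\<forall>x\<in>univ N. k ((e \<circ> d) x) = (e \<circ> d) (g x))"
    if g: "automorphism L N g" for g
  proof -
    obtain h where h: "automorphism L M h" "\<forall>x\<in>univ N. h (d x) = d (g x)"
      using d g unfolding symmetric_embedding_iff[OF N] by blast
    obtain k where "automorphism L K k" "\<forall>y\<in>univ M. k (e y) = e (h y)"
      using e h(1) unfolding symmetric_embedding_iff[OF M] by blast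
    with h dm show ?thesis
      by (metis PiE comp_apply)
  qed
  then show ?thesis
    using d e embedding_comp by (auto simp: symmetric_embedding_iff[OF N] symmetric_embedding_iff[OF M])
qed

text \<open>As \<open>e\<close> is onto, the conjugate of an automorphism of \<open>N\<close> is
  already an automorphism of the whole of \<open>M\<close>, hence its own extension.\<close>

lemma isomorphism_imp_symmetric_embedding:
  assumes N: "is_structure L N" and e: "isomorphism L N M e"
  shows "symmetric_embedding L N M e"
  unfolding symmetric_embedding_iff[OF N]
proof (intro conjI allI impI)
  show emb: "embedding L N M e"
    using e by (simp add: isomorphism_def)
  fix g assume "automorphism L N g"
  then have "automorphism L M (e \<circ> (g \<circ> inv_into (univ N) e))"
    using e isomorphism_inv_into[OF N e] unfolding automorphism_def
    by (blast intro: isomorphism_comp)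
  then show "\<exists>h. automorphism L M h \<and> (\<forall>x\<in>univ N. h (e x) = e (g x))"
    using emb by (intro exI conjI) (auto simp: embedding_def)
qed

text \<open>The extension condition depends on \<open>e\<close> only through its image, and the
  inclusion of \<open>?I\<close> has the same image, so symmetry passes to it unchanged.\<close>

lemma sym_embedded_induced_image:
  assumes N: "is_structure L N" and e: "symmetric_embedding L N M e"
  shows "sym_embedded L (induced L M (e ` univ N)) M"
proof -
  let ?I = "induced L M (e ` univ N)"
  have emb: "embedding L N M e"
    using e by (simp add: symmetric_embedding_def)
  then have "e ` univ N \<subseteq> univ M"
    by (auto simp: embedding_def)
  then have "embedding L ?I M (\<lambda>x. x)"
    by (auto simp: embedding_def induced_def)
  with e have "symmetric_embedding L ?I M (\<lambda>x. x)"
    by (simp add: symmetric_embedding_def induced_def)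
  then show ?thesis
    using is_structure_induced_image[OF N emb] \<open>e ` univ N \<subseteq> univ M\<close>
    by (simp add: sym_embedded_def substructure_def symmetric_embedding_def induced_def)
qed

section \<open>Transfer of symmetric indivisibility\<close>

lemma isomorphic_sym:
  assumes "is_structure L N" "isomorphic L N M"
  shows "isomorphic L M N"
  using assms isomorphism_inv_into unfolding isomorphic_def by blast

lemma symmetrically_indivisible_mutual:
  fixes A :: "('f, 'r, 'a) fo_structure" and M :: "('f, 'r, 'b) fo_structure"
  assumes A: "is_structure L A" and M: "is_structure L M"
    and indiv: "symmetrically_indivisible L M"
    and "sym_embeds L A M" "sym_embeds L M A"
  shows "symmetrically_indivisible L A"
  unfolding symmetrically_indivisible_def
proof
  fix c :: "'a \<Rightarrow> bool"
  obtain d e where d: "symmetric_embedding L A M d" and e: "symmetric_embedding L M A e"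
    using assms unfolding sym_embeds_def by blast
  \<comment> \<open>The colouring \<open>c \<circ> e\<close> gives each point of \<open>M\<close>
    the colour of its image in \<open>A\<close>.\<close>
  obtain M' k where sub: "substructure L M' M" and k: "\<forall>x\<in>univ M'. (c \<circ> e) x = k"
    and iso: "isomorphic L M' M" and incl: "symmetric_embedding L M' M (\<lambda>x. x)"
    using indiv[unfolded symmetrically_indivisible_def, rule_format, of "c \<circ> e"]
    unfolding sym_embedded_def by blast
  have M': "is_structure L M'"
    using sub by (simp add: substructure_def)
  obtain h where h: "isomorphism L M M' h"
    using isomorphic_sym[OF M' iso] unfolding isomorphic_def by blast
  \<comment> \<open>The identity factor is the inclusion of \<open>M'\<close> into \<open>M\<close>.
    It is kept as a separate factor because it contributes its own symmetry to the
    composite.\<close>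
  define s where "s = e \<circ> ((\<lambda>x. x) \<circ> (h \<circ> d))"
  have s: "symmetric_embedding L A A s"
    unfolding s_def
    by (intro symmetric_embedding_comp[OF A M] symmetric_embedding_comp[OF A M']
        d incl e isomorphism_imp_symmetric_embedding[OF M h])
  let ?A' = "induced L A (s ` univ A)"
  have emb: "sym_embedded L ?A' A"
    using A s by (rule sym_embedded_induced_image)
  have "isomorphism L A ?A' s"
    using s embedding_iso_induced unfolding symmetric_embedding_def by blast
  then have "isomorphic L ?A' A"
    using isomorphic_sym[OF A] unfolding isomorphic_def by blast
  \<comment> \<open>\<open>s x\<close> is the \<open>e\<close>-image of a point of
    \<open>M'\<close>, on which \<open>c \<circ> e\<close> is constantly \<open>k\<close>.\<close>
  moreover have "c (s x) = k" if "x \<in> univ A" for x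
  proof -
    have "h (d x) \<in> univ M'"
      using that d h
      by (auto simp: symmetric_embedding_def embedding_def isomorphism_def)
    with k show ?thesis
      by (simp add: s_def)
  qed
  then have "\<forall>x\<in>univ ?A'. c x = k"
    by (auto simp: induced_def)
  ultimately show "\<exists>A'. substructure L A' A \<and> (\<exists>k. \<forall>x\<in>univ A'. c x = k) \<and>
      isomorphic L A' A \<and> sym_embedded L A' A"
    using emb unfolding sym_embedded_def by blast
qed

section \<open>Isomorphism classes and the injection between them\<close>

lemma equiv_iso_rel:
  assumes "\<And>A. A \<in> S \<Longrightarrow> is_structure L A"
  shows "equiv S (iso_rel L S)"
proof (rule equivI)
  show "iso_rel L S \<subseteq> S \<times> S"
    by (auto simp: iso_rel_def)
  show "refl_on S (iso_rel L S)"
    by (auto simp: refl_on_def iso_rel_def isomorphic_def intro: isomorphism_id)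
  \<comment> \<open>Inverting an isomorphism is where members of \<open>S\<close> must be genuine
    structures.\<close>
  show "sym (iso_rel L S)"
    using assms isomorphic_sym by (fastforce simp: sym_def iso_rel_def)
  show "trans (iso_rel L S)"
    using isomorphism_comp by (fastforce simp: trans_def iso_rel_def isomorphic_def)
qed

theorem proposition2p17:
  fixes L :: "('f, 'r) language"
    and C :: "('f, 'r, 'a) fo_structure set"
    and M :: "('f, 'r, 'a) fo_structure"
    and plus :: "('f, 'r, 'a) fo_structure \<Rightarrow> ('f, 'r, 'a) fo_structure \<Rightarrow> ('f, 'r, 'a) fo_structure"
  assumes "\<And>A. A \<in> C \<Longrightarrow> is_structure L A"
    and "\<And>A. A \<in> C \<Longrightarrow> countable (univ A)"
    and "M \<in> C"
    and "symmetrically_indivisible L M"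
    and "\<And>A. A \<in> C \<Longrightarrow> sym_embeds L A M"
    and "\<And>A B. A \<in> C \<Longrightarrow> B \<in> C \<Longrightarrow> plus A B \<in> C"
    and "\<And>C1 C2. C1 \<in> C \<Longrightarrow> C2 \<in> C \<Longrightarrow>
           isomorphic L (plus M C1) (plus M C2) \<Longrightarrow> isomorphic L C1 C2"
    and "\<And>A B. A \<in> C \<Longrightarrow> B \<in> C \<Longrightarrow> sym_embeds L A (plus A B)"
    and "\<And>A B. A \<in> C \<Longrightarrow> B \<in> C \<Longrightarrow> sym_embeds L B (plus A B)"
  shows "\<exists>F. F \<in> iso_classes L C \<rightarrow> iso_classes L {A \<in> C. symmetrically_indivisible L A} \<and>
             inj_on F (iso_classes L C)"
proof -
  let ?S = "{A \<in> C. symmetrically_indivisible L A}"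
  \<comment> \<open>\<open>plus\<close> is not assumed to respect isomorphism, so it need not act on
    classes; fixing one representative per class makes \<open>F\<close> well defined.\<close>
  define rep where "rep X = (SOME A. A \<in> X)" for X :: "('f, 'r, 'a) fo_structure set"
  define F where "F X = iso_rel L ?S `` {plus M (rep X)}" for X
  have equivC: "equiv C (iso_rel L C)" and equivS: "equiv ?S (iso_rel L ?S)"
    using assms(1) by (auto intro: equiv_iso_rel)
  have rep: "rep X \<in> X" "rep X \<in> C" if "X \<in> iso_classes L C" for X
  proof -
    have "X \<noteq> {}" "X \<subseteq> C"
      using that equivC in_quotient_imp_non_empty in_quotient_imp_subset
      unfolding iso_classes_def by blast+
    moreover from \<open>X \<noteq> {}\<close> show "rep X \<in> X"
      by (simp add: rep_def some_in_eq)
    ultimately show "rep X \<in> C"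
      by blast
  qed
  have plus_S: "plus M A \<in> ?S" if "A \<in> C" for A
  proof -
    have "plus M A \<in> C"
      using assms(3,6) that by simp
    \<comment> \<open>The sum embeds into \<open>M\<close> because it lies in \<open>C\<close>, and
      \<open>M\<close> embeds into it as the left summand.\<close>
    moreover have "symmetrically_indivisible L (plus M A)"
      using symmetrically_indivisible_mutual[OF assms(1) assms(1) assms(4) assms(5) assms(8)]
        calculation assms(3) that by simp
    ultimately show ?thesis
      by simp
  qed
  have "F X \<in> iso_classes L ?S" if "X \<in> iso_classes L C" for X
    using plus_S[OF rep(2)[OF that]] unfolding F_def iso_classes_def by (rule quotientI)
  moreover have "X = Y"
    if X: "X \<in> iso_classes L C" and Y: "Y \<in> iso_classes L C" and "F X = F Y" for X Y
  proof -
    \<comment> \<open>Equal values of \<open>F\<close> make the two sums isomorphic; cancelling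
      \<open>M\<close> then makes the representatives isomorphic, so their classes coincide.\<close>
    have "(plus M (rep X), plus M (rep Y)) \<in> iso_rel L ?S"
      using \<open>F X = F Y\<close> plus_S[OF rep(2)[OF Y]] unfolding F_def
      by (rule eq_equiv_class[OF _ equivS])
    then have "isomorphic L (rep X) (rep Y)"
      using assms(7) rep(2)[OF X] rep(2)[OF Y] by (simp add: iso_rel_def)
    then have "(rep X, rep Y) \<in> iso_rel L C"
      using rep(2)[OF X] rep(2)[OF Y] by (simp add: iso_rel_def)
    then show "X = Y"
      using quotient_eqI[OF equivC] X Y rep(1)[OF X] rep(1)[OF Y] unfolding iso_classes_def by blast
  qed
  ultimately show ?thesis
    by (intro exI[of _ F]) (auto simp: inj_on_def)
qed

end
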